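(* The descent number statistic $\mathrm{des}$, the ascent number statistic $\mathrm{asc}$, the major index statistic $\mathrm{maj}$, and the cliff number statistic $\mathrm{cliff}$ are each shuffle-compatible on words.
   Context: A word of length $n\ge0$ is a sequence $\alpha=(\alpha_1,\dots,\alpha_n)$ of positive integers; $|\alpha|=n$; $W$ is the set of all words. If the distinct letters of $\alpha$ are $a_1<\dots<a_k$, then $\mathrm{pack}(\alpha)$ is obtained by replacing each $a_i$ by $i$. Two words are disjoint if they have no common letter. $\mathrm{Sh}(\alpha,\beta)$ is the multiset of all $\binom{|\alpha|+|\beta|}{|\alpha|}$ interleavings (shuffles) of $\alpha$ and $\beta$. For $\alpha\in W$ of length $n$: $\mathrm{des}(\alpha)=|\{i\in[n-1]:\alpha_i>\alpha_{i+1}\}|$; $\mathrm{asc}(\alpha)=|\{i\in[n-1]:\alpha_i<\alpha_{i+1}\}|$; $\mathrm{maj}(\alpha)=\sum_{i\in[n-1],\,\alpha_i>\alpha_{i+1}}i$; $\mathrm{cliff}(\alpha)=|\{i:2\le i\le n-1,\ \alpha_{i-1}\le\alpha_i>\alpha_{i+1}\}|$. A statistic $\mathrm{st}$ (function on $W$) is shuffle-compatible on words if (i) for all disjoint words $\alpha,\beta$ the multiset $\{\{\mathrm{st}(\gamma):\gamma\in \mathrm{Sh}(\alpha,\beta)\}\}$ is determined by $|\alpha|,|\beta|,\mathrm{st}(\alpha),\mathrm{st}(\beta)$; and (ii) $\mathrm{pack}(\alpha)=\mathrm{pack}(\beta)$ implies $\mathrm{st}(\alpha)=\mathrm{st}(\beta)$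 for all words $\alpha,\beta$. *)

theory Defs
  imports Main "HOL-Library.Multiset"
begin

definition words :: "nat list set" where
  "words = {\<alpha>. \<forall>a\<in>set \<alpha>. a \<ge> 1}"

text \<open>The \<open>i\<close>-th smallest letter of \<open>\<alpha>\<close> is the one having exactly \<open>i\<close> letters of \<open>\<alpha>\<close>
  below or equal to it.\<close>

definition pack :: "nat list \<Rightarrow> nat list" where
  "pack \<alpha> = map (\<lambda>a. card {b \<in> set \<alpha>. b \<le> a}) \<alpha>"

definition disjoint_words :: "nat list \<Rightarrow> nat list \<Rightarrow> bool" where
  "disjoint_words \<alpha> \<beta> \<longleftrightarrow> set \<alpha> \<inter> set \<beta> = {}"

text \<open>\<^const>\<open>shuffles\<close> is only the set of interleavings; \<open>Sh\<close> counts each with its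
  multiplicity.\<close>

fun Sh :: "'a list \<Rightarrow> 'a list \<Rightarrow> 'a list multiset" where
  "Sh [] \<beta> = {#\<beta>#}"
| "Sh \<alpha> [] = {#\<alpha>#}"
| "Sh (a # \<alpha>) (b # \<beta>) =
     image_mset ((#) a) (Sh \<alpha> (b # \<beta>)) + image_mset ((#) b) (Sh (a # \<alpha>) \<beta>)"

lemma set_mset_Sh: "set_mset (Sh \<alpha> \<beta>) = shuffles \<alpha> \<beta>"
  by (induction \<alpha> \<beta> rule: Sh.induct) auto

lemma size_Sh: "size (Sh \<alpha> \<beta>) = (length \<alpha> + length \<beta>) choose length \<alpha>"
  by (induction \<alpha> \<beta> rule: Sh.induct) (auto simp: add.commute)

text \<open>Lists are indexed from 0, so the letter \<open>\<alpha>\<^sub>i\<close> is \<open>\<alpha> ! (i - 1)\<close>; the position \<open>i\<close> itself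
  is kept 1-based, which matters for \<open>maj\<close>.\<close>

definition des :: "nat list \<Rightarrow> nat" where
  "des \<alpha> = card {i \<in> {1..<length \<alpha>}. \<alpha> ! (i - 1) > \<alpha> ! i}"

definition asc :: "nat list \<Rightarrow> nat" where
  "asc \<alpha> = card {i \<in> {1..<length \<alpha>}. \<alpha> ! (i - 1) < \<alpha> ! i}"

definition maj :: "nat list \<Rightarrow> nat" where
  "maj \<alpha> = \<Sum>{i \<in> {1..<length \<alpha>}. \<alpha> ! (i - 1) > \<alpha> ! i}"

definition cliff :: "nat list \<Rightarrow> nat" where
  "cliff \<alpha> = card {i \<in> {2..<length \<alpha>}. \<alpha> ! (i - 2) \<le> \<alpha> ! (i - 1) \<and> \<alpha> ! (i - 1) > \<alpha> ! i}"

definition shuffle_compatible_on_words :: "(nat list \<Rightarrow> 'b) \<Rightarrow> bool" where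
  "shuffle_compatible_on_words st \<longleftrightarrow>
     (\<forall>\<alpha>\<in>words. \<forall>\<beta>\<in>words. \<forall>\<alpha>'\<in>words. \<forall>\<beta>'\<in>words.
        disjoint_words \<alpha> \<beta> \<and> disjoint_words \<alpha>' \<beta>' \<and>
        length \<alpha> = length \<alpha>' \<and> length \<beta> = length \<beta>' \<and>
        st \<alpha> = st \<alpha>' \<and> st \<beta> = st \<beta>' \<longrightarrow>
        image_mset st (Sh \<alpha> \<beta>) = image_mset st (Sh \<alpha>' \<beta>')) \<and>
     (\<forall>\<alpha>\<in>words. \<forall>\<beta>\<in>words. pack \<alpha> = pack \<beta> \<longrightarrow> st \<alpha> = st \<beta>)"

end

theory Submission
  imports Defs "HOL-Computational_Algebra.Formal_Power_Series"
begin

text \<open>The deconcatenation coproduct respects shuffles, so the functions on words that are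
  multiplicative on shuffles of disjoint words are closed under convolution; the indicator of the
  words sorted with respect to a linear order is one of them. The \<open>p\<close>-th convolution power of
  the indicator of weakly increasing words is a binomial coefficient in the length and the descent
  number, and it vanishes exactly for \<open>p \<le> des\<close> on
  nonempty words. By this triangularity the powers determine the
  distribution of \<^const>\<open>des\<close> over the shuffles. Reversing the order gives \<^const>\<open>asc\<close>.
  For \<^const>\<open>cliff\<close> the weakly increasing and the strictly decreasing indicator alternate, and for
  \<^const>\<open>maj\<close> the function \<open>q\<^bsup>maj\<^esup> / ((1 - q) \<dots> (1 - q\<^sup>n))\<close> is multiplicative because it is the
  fixed point of a \<open>q\<close>-weighted convolution.\<close>

section \<open>Characters of the shuffle product and their convolution\<close>

definition shuffle_character :: "('a list \<Rightarrow> 'b::comm_semiring_1) \<Rightarrow> bool" where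
  "shuffle_character \<phi> \<longleftrightarrow>
     (\<forall>\<alpha> \<beta>. set \<alpha> \<inter> set \<beta> = {} \<longrightarrow> (\<Sum>\<gamma>\<in>#Sh \<alpha> \<beta>. \<phi> \<gamma>) = \<phi> \<alpha> * \<phi> \<beta>)"

definition conv :: "('a list \<Rightarrow> 'b::comm_semiring_1) \<Rightarrow> ('a list \<Rightarrow> 'b) \<Rightarrow> 'a list \<Rightarrow> 'b" where
  "conv \<phi> \<psi> \<gamma> = (\<Sum>k\<le>length \<gamma>. \<phi> (take k \<gamma>) * \<psi> (drop k \<gamma>))"

definition unit_character :: "'a list \<Rightarrow> 'b::comm_semiring_1" where
  "unit_character \<gamma> = of_bool (\<gamma> = [])"

definition sorted_character :: "('a \<Rightarrow> 'a \<Rightarrow> bool) \<Rightarrow> 'a list \<Rightarrow> 'b::comm_semiring_1" where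
  "sorted_character R \<gamma> = of_bool (sorted_wrt R \<gamma>)"

lemma Sh_Nil2 [simp]: "Sh \<alpha> [] = {#\<alpha>#}"
  by (cases \<alpha>) auto

lemma length_of_mem_Sh: "\<gamma> \<in># Sh \<alpha> \<beta> \<Longrightarrow> length \<gamma> = length \<alpha> + length \<beta>"
  by (metis set_mset_Sh length_shuffles)

lemma set_of_mem_Sh: "\<gamma> \<in># Sh \<alpha> \<beta> \<Longrightarrow> set \<gamma> = set \<alpha> \<union> set \<beta>"
  by (metis set_mset_Sh set_shuffles)

subsection \<open>Deconcatenation and shuffles\<close>

text \<open>In every cut with a nonempty prefix the head letter belongs to the prefix, so it can be
  absorbed into \<open>F\<close>; this drives an induction with \<open>F\<close> arbitrary.\<close>

lemma sum_deconcat_Cons: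
  "(\<Sum>k\<le>length (a # \<gamma>). F (take k (a # \<gamma>)) (drop k (a # \<gamma>))) =
     F [] (a # \<gamma>) + (\<Sum>k\<le>length \<gamma>. F (a # take k \<gamma>) (drop k \<gamma>))"
  for F :: "'a list \<Rightarrow> 'a list \<Rightarrow> 'b::comm_monoid_add"
  by (simp add: sum.atMost_Suc_shift del: sum.atMost_Suc)

text \<open>Compatibility of the shuffle product with the deconcatenation coproduct.\<close>

lemma sum_Sh_deconcat:
  fixes F :: "'a list \<Rightarrow> 'a list \<Rightarrow> 'b::comm_monoid_add"
  shows "(\<Sum>\<gamma>\<in>#Sh \<alpha> \<beta>. \<Sum>k\<le>length \<gamma>. F (take k \<gamma>) (drop k \<gamma>)) =
    (\<Sum>i\<le>length \<alpha>. \<Sum>j\<le>length \<beta>.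
       \<Sum>\<gamma>\<^sub>1\<in>#Sh (take i \<alpha>) (take j \<beta>). \<Sum>\<gamma>\<^sub>2\<in>#Sh (drop i \<alpha>) (drop j \<beta>). F \<gamma>\<^sub>1 \<gamma>\<^sub>2)"
proof (induction \<alpha> \<beta> arbitrary: F rule: Sh.induct)
  case (3 a \<alpha> b \<beta>)
  \<comment> \<open>A nonempty prefix of a shuffle starts with \<open>a\<close> or \<open>b\<close>;
    this letter moves into \<open>F\<close>, which leaves a cut shuffle of shorter words.\<close>
  note IH1 = "3.IH"(1)[of "\<lambda>u. F (a # u)"]
  note IH2 = "3.IH"(2)[of "\<lambda>u. F (b # u)"]
  have "(\<Sum>\<gamma>\<in>#Sh (a # \<alpha>) (b # \<beta>). \<Sum>k\<le>length \<gamma>. F (take k \<gamma>) (drop k \<gamma>)) =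
     (\<Sum>\<gamma>\<in>#Sh (a # \<alpha>) (b # \<beta>). F [] \<gamma>)
     + (\<Sum>\<gamma>\<in>#Sh \<alpha> (b # \<beta>). \<Sum>k\<le>length \<gamma>. F (a # take k \<gamma>) (drop k \<gamma>))
     + (\<Sum>\<gamma>\<in>#Sh (a # \<alpha>) \<beta>. \<Sum>k\<le>length \<gamma>. F (b # take k \<gamma>) (drop k \<gamma>))"
    by (simp only: Sh.simps image_mset_union sum_mset.union image_mset.compositionality o_def
        sum_deconcat_Cons sum_mset.distrib) (simp add: ac_simps)
  also have "\<dots> = (\<Sum>i\<le>length (a # \<alpha>). \<Sum>j\<le>length (b # \<beta>).
       \<Sum>\<gamma>\<^sub>1\<in>#Sh (take i (a # \<alpha>)) (take j (b # \<beta>)).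
       \<Sum>\<gamma>\<^sub>2\<in>#Sh (drop i (a # \<alpha>)) (drop j (b # \<beta>)). F \<gamma>\<^sub>1 \<gamma>\<^sub>2)"
    unfolding IH1 IH2
    by (simp add: sum.atMost_Suc_shift image_mset.compositionality o_def sum.distrib ac_simps
        del: sum.atMost_Suc)
  finally show ?case .
qed simp_all

lemma sum_Sh_conv:
  fixes \<phi> \<psi> :: "'a list \<Rightarrow> 'b::comm_semiring_1"
  shows "(\<Sum>\<gamma>\<in>#Sh \<alpha> \<beta>. conv \<phi> \<psi> \<gamma>) =
    (\<Sum>i\<le>length \<alpha>. \<Sum>j\<le>length \<beta>.
       (\<Sum>\<gamma>\<in>#Sh (take i \<alpha>) (take j \<beta>). \<phi> \<gamma>) * (\<Sum>\<gamma>\<in>#Sh (drop i \<alpha>) (drop j \<beta>). \<psi> \<gamma>))"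
  unfolding conv_def sum_Sh_deconcat[of "\<lambda>u v. \<phi> u * \<psi> v"]
  by (simp flip: sum_mset_distrib_left sum_mset_distrib_right)

lemma disjoint_take_drop:
  assumes "set \<alpha> \<inter> set \<beta> = {}"
  shows "set (take i \<alpha>) \<inter> set (take j \<beta>) = {}" "set (drop i \<alpha>) \<inter> set (drop j \<beta>) = {}"
  using assms set_take_subset[of i \<alpha>] set_take_subset[of j \<beta>]
    set_drop_subset[of i \<alpha>] set_drop_subset[of j \<beta>] by blast+

lemma shuffle_character_conv:
  assumes "shuffle_character \<phi>" "shuffle_character \<psi>"
  shows "shuffle_character (conv \<phi> \<psi>)"
  unfolding shuffle_character_def
proof (intro allI impI)
  fix \<alpha> \<beta> :: "'a list" assume d: "set \<alpha> \<inter> set \<beta> = {}"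
  note dd = disjoint_take_drop[OF d]
  have "(\<Sum>\<gamma>\<in>#Sh \<alpha> \<beta>. conv \<phi> \<psi> \<gamma>) = (\<Sum>i\<le>length \<alpha>. \<Sum>j\<le>length \<beta>.
     \<phi> (take i \<alpha>) * \<phi> (take j \<beta>) * (\<psi> (drop i \<alpha>) * \<psi> (drop j \<beta>)))"
    using assms dd by (simp add: sum_Sh_conv shuffle_character_def)
  then show "(\<Sum>\<gamma>\<in>#Sh \<alpha> \<beta>. conv \<phi> \<psi> \<gamma>) = conv \<phi> \<psi> \<alpha> * conv \<phi> \<psi> \<beta>"
    by (simp add: conv_def sum_product ac_simps)
qed

lemma shuffle_character_unit: "shuffle_character unit_character"
proof -
  have "(\<Sum>\<gamma>\<in>#Sh \<alpha> \<beta>. unit_character \<gamma> :: 'b) = unit_character \<alpha> * unit_character \<beta>" for \<alpha> \<beta> :: "'a list"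
    by (induction \<alpha> \<beta> rule: Sh.induct)
      (simp_all add: unit_character_def image_mset.compositionality o_def)
  then show ?thesis by (simp add: shuffle_character_def)
qed

text \<open>Two sorted words with disjoint letters have exactly one sorted shuffle, their merge, and
  an unsorted factor spoils every shuffle. Totality is asked of distinct letters only, so weak and
  strict orders are covered alike.\<close>

lemma shuffle_character_sorted:
  assumes tr: "transp R" and tot: "\<And>a b. a \<noteq> b \<Longrightarrow> R a b \<noteq> R b a"
  shows "shuffle_character (sorted_character R :: 'a list \<Rightarrow> 'b::comm_semiring_1)"
proof -
  let ?z = "sorted_character R :: 'a list \<Rightarrow> 'b"
  have "set \<alpha> \<inter> set \<beta> = {} \<Longrightarrow> (\<Sum>\<gamma>\<in>#Sh \<alpha> \<beta>. ?z \<gamma>) = ?z \<alpha> * ?z \<beta>" for \<alpha> \<beta>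
  proof (induction \<alpha> \<beta> rule: Sh.induct)
    case (3 a \<alpha> b \<beta>)
    have z: "?z (c # \<gamma>) = of_bool (\<forall>x\<in>set \<gamma>. R c x) * ?z \<gamma>" for c \<gamma>
      by (simp add: sorted_character_def)
    \<comment> \<open>All shuffles of the same two words have the same letters, so the condition on
      the new head \<open>c\<close> leaves the sum.\<close>
    have sm: "(\<Sum>\<gamma>\<in>#Sh \<sigma> \<tau>. ?z (c # \<gamma>)) =
        of_bool (\<forall>x\<in>set \<sigma> \<union> set \<tau>. R c x) * (\<Sum>\<gamma>\<in>#Sh \<sigma> \<tau>. ?z \<gamma>)" for c \<sigma> \<tau>
      unfolding sum_mset_distrib_left z
      by (intro arg_cong[where f = sum_mset] image_mset_cong) (simp add: set_of_mem_Sh)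
    have "(\<Sum>\<gamma>\<in>#Sh (a # \<alpha>) (b # \<beta>). ?z \<gamma>) =
        of_bool (\<forall>x\<in>set \<alpha> \<union> set (b # \<beta>). R a x) * (?z \<alpha> * ?z (b # \<beta>)) +
        of_bool (\<forall>x\<in>set (a # \<alpha>) \<union> set \<beta>. R b x) * (?z (a # \<alpha>) * ?z \<beta>)"
      using 3 by (simp add: image_mset.compositionality o_def sm)
    \<comment> \<open>Only one of the two heads can come first; transitivity through the other head
      then covers the letters behind it.\<close>
    moreover have "R a b \<noteq> R b a" using 3 tot[of a b] by auto
    ultimately show ?case
      using tr by (auto simp: sorted_character_def dest: transpD)
  qed (simp_all add: sorted_character_def)
  then show ?thesis by (simp add: shuffle_character_def)
qed

section \<open>Convolution with the indicator of sorted words\<close>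

lemma conv_sorted_Nil: "conv \<phi> (sorted_character R) [] = \<phi> []"
  by (simp add: conv_def sorted_character_def)

lemma conv_sorted_singleton: "conv \<phi> (sorted_character R) [x] = \<phi> [x] + \<phi> []"
  by (simp add: conv_def sorted_character_def add.commute)

lemma sorted_wrt_snoc:
  assumes "transp R" "\<gamma> \<noteq> []"
  shows "sorted_wrt R (\<gamma> @ [x]) \<longleftrightarrow> sorted_wrt R \<gamma> \<and> R (last \<gamma>) x"
  using assms by (cases \<gamma> rule: rev_cases) (auto simp: sorted_wrt_append dest: transpD)

text \<open>The cut after \<open>x\<close> gives the first summand, the cut just before
  \<open>x\<close> gives \<open>\<phi> \<gamma>\<close>. The earlier cuts survive exactly if
  \<open>R (last \<gamma>) x\<close>, and together with \<open>\<phi> \<gamma>\<close> they then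
  form the convolution at \<open>\<gamma>\<close>. The recursions below for all statistics come from
  this.\<close>

lemma conv_sorted_snoc:
  fixes \<phi> :: "'a list \<Rightarrow> 'b::comm_semiring_1"
  assumes tr: "transp R" and ne: "\<gamma> \<noteq> []"
  shows "conv \<phi> (sorted_character R) (\<gamma> @ [x]) =
     \<phi> (\<gamma> @ [x]) + (if R (last \<gamma>) x then conv \<phi> (sorted_character R) \<gamma> else \<phi> \<gamma>)"
proof -
  let ?n = "length \<gamma>"
  let ?z = "sorted_character R :: 'a list \<Rightarrow> 'b"
  have z: "?z (drop k \<gamma> @ [x]) = of_bool (R (last \<gamma>) x) * ?z (drop k \<gamma>)" if "k < ?n" for k
    using that ne by (simp add: sorted_character_def sorted_wrt_snoc[OF tr])
  have 1: "conv \<phi> ?z \<gamma> = (\<Sum>k<?n. \<phi> (take k \<gamma>) * ?z (drop k \<gamma>)) + \<phi> \<gamma>"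
    unfolding conv_def lessThan_Suc_atMost[symmetric] sum.lessThan_Suc
    by (simp add: sorted_character_def)
  have "conv \<phi> ?z (\<gamma> @ [x]) =
      (\<Sum>k<?n. \<phi> (take k \<gamma>) * ?z (drop k \<gamma> @ [x])) + \<phi> \<gamma> + \<phi> (\<gamma> @ [x])"
    unfolding conv_def length_append_singleton lessThan_Suc_atMost[symmetric] sum.lessThan_Suc
    by (simp add: sorted_character_def)
  also have "(\<Sum>k<?n. \<phi> (take k \<gamma>) * ?z (drop k \<gamma> @ [x])) =
      of_bool (R (last \<gamma>) x) * (\<Sum>k<?n. \<phi> (take k \<gamma>) * ?z (drop k \<gamma>))"
    by (simp add: sum_distrib_left z ac_simps)
  finally show ?thesis by (simp add: 1 add.commute)
qed

subsection \<open>Recovering a statistic from a triangular family of characters\<close>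

text \<open>At the least value of \<open>st\<close> on \<open>A + B\<close>, the function indexed by
  this value detects only elements attaining it. As the sums agree, both multisets contain such an
  element; removing one from each leaves a smaller instance.\<close>

lemma image_mset_eq_if_triangular:
  fixes st :: "'a \<Rightarrow> nat" and \<phi> :: "nat \<Rightarrow> 'a \<Rightarrow> nat"
  assumes det: "\<And>p x y. x \<in># A + B \<Longrightarrow> y \<in># A + B \<Longrightarrow> st x = st y \<Longrightarrow> \<phi> p x = \<phi> p y"
    and zero: "\<And>p x. x \<in># A + B \<Longrightarrow> p < st x \<Longrightarrow> \<phi> p x = 0"
    and pos: "\<And>x. x \<in># A + B \<Longrightarrow> \<phi> (st x) x > 0"
    and eq: "\<And>p. (\<Sum>x\<in>#A. \<phi> p x) = (\<Sum>x\<in>#B. \<phi> p x)"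
  shows "image_mset st A = image_mset st B"
  using assms
proof (induction "size A" arbitrary: A B rule: less_induct)
  case less
  show ?case
  proof (cases "A + B = {#}")
    case False
    then obtain x\<^sub>0 where "x\<^sub>0 \<in># A + B" by (meson multiset_nonemptyE)
    then obtain x where x: "x \<in># A + B" "\<And>y. y \<in># A + B \<Longrightarrow> st x \<le> st y"
      using ex_has_least_nat[of "\<lambda>x. x \<in># A + B" x\<^sub>0 st] by blast
    \<comment> \<open>An element with a nonzero contribution has \<open>st\<close> at most
      \<open>st x\<close> by \<open>zero\<close>, and at least \<open>st x\<close> by
      minimality.\<close>
    have hit: "\<exists>y\<in>#C. st y = st x" if "(\<Sum>y\<in>#C. \<phi> (st x) y) > 0" "C \<subseteq># A + B" for C
    proof -
      have "\<exists>y\<in>#C. \<phi> (st x) y > 0" using that(1) by (induction C) auto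
      then obtain y where y: "y \<in># C" "\<phi> (st x) y > 0" by blast
      have "y \<in># A + B" using y(1) that(2) by (rule mset_subset_eqD[rotated])
      then have "st x \<le> st y" "\<not> st x < st y" using x(2) y(2) less.prems(2)[of y "st x"] by auto
      then show ?thesis using y(1) by auto
    qed
    have "(\<Sum>y\<in>#C. \<phi> (st x) y) > 0" if "x \<in># C" for C
      using that less.prems(3)[OF x(1)] by (auto dest!: multi_member_split)
    then have "(\<Sum>y\<in>#A. \<phi> (st x) y) > 0"
      using x(1) less.prems(4)[of "st x"] by (metis union_iff)
    then obtain a b where ab: "a \<in># A" "st a = st x" "b \<in># B" "st b = st x"
      using hit[of A] hit[of B] less.prems(4)[of "st x"] by auto
    then obtain A' B' where AB: "A = add_mset a A'" "B = add_mset b B'"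
      by (meson multi_member_split)
    have \<phi>: "\<phi> p a = \<phi> p b" for p using ab by (intro less.prems(1)) auto
    have sub: "z \<in># A' + B' \<Longrightarrow> z \<in># A + B" for z using AB by auto
    have "image_mset st A' = image_mset st B'"
    proof (rule less.hyps)
      show "(\<Sum>x\<in>#A'. \<phi> p x) = (\<Sum>x\<in>#B'. \<phi> p x)" for p
        using less.prems(4)[of p] by (simp add: AB \<phi>)
      show "\<phi> p x = \<phi> p y" if "x \<in># A' + B'" "y \<in># A' + B'" "st x = st y" for p x y
        by (rule less.prems(1)[OF sub[OF that(1)] sub[OF that(2)] that(3)])
      show "\<phi> p x = 0" if "x \<in># A' + B'" "p < st x" for p x
        by (rule less.prems(2)[OF sub[OF that(1)] that(2)])
      show "\<phi> (st x) x > 0" if "x \<in># A' + B'" for x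
        by (rule less.prems(3)[OF sub[OF that]])
    qed (simp add: AB(1))
    then show ?thesis using AB ab by simp
  qed auto
qed

text \<open>All shuffles involved have the same length, so on them the characters are functions of
  \<open>st\<close>; their sums are products of values at the two factors, hence equal.\<close>

lemma image_mset_Sh_eq_if_triangular:
  fixes st :: "'a list \<Rightarrow> nat" and \<phi> :: "nat \<Rightarrow> 'a list \<Rightarrow> nat"
  assumes char: "\<And>p. shuffle_character (\<phi> p)"
    and det: "\<And>p \<gamma> \<gamma>'. length \<gamma> = length \<gamma>' \<Longrightarrow> st \<gamma> = st \<gamma>' \<Longrightarrow> \<phi> p \<gamma> = \<phi> p \<gamma>'"
    and zero: "\<And>p \<gamma>. p < st \<gamma> \<Longrightarrow> \<phi> p \<gamma> = 0"
    and pos: "\<And>\<gamma>. \<phi> (st \<gamma>) \<gamma> > 0"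
    and disj: "set \<alpha> \<inter> set \<beta> = {}" "set \<alpha>' \<inter> set \<beta>' = {}"
    and len: "length \<alpha> = length \<alpha>'" "length \<beta> = length \<beta>'"
    and st: "st \<alpha> = st \<alpha>'" "st \<beta> = st \<beta>'"
  shows "image_mset st (Sh \<alpha> \<beta>) = image_mset st (Sh \<alpha>' \<beta>')"
proof (rule image_mset_eq_if_triangular[where \<phi> = \<phi>])
  show "\<phi> p \<gamma> = \<phi> p \<gamma>'" if "\<gamma> \<in># Sh \<alpha> \<beta> + Sh \<alpha>' \<beta>'" "\<gamma>' \<in># Sh \<alpha> \<beta> + Sh \<alpha>' \<beta>'" "st \<gamma> = st \<gamma>'"
    for p \<gamma> \<gamma>'
    using that len by (intro det) (auto dest!: length_of_mem_Sh)
  show "(\<Sum>\<gamma>\<in>#Sh \<alpha> \<beta>. \<phi> p \<gamma>) = (\<Sum>\<gamma>\<in>#Sh \<alpha>' \<beta>'. \<phi> p \<gamma>)" for p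
    using char[of p] disj det[OF len(1) st(1)] det[OF len(2) st(2)]
    by (simp add: shuffle_character_def)
qed (use zero pos in auto)

subsection \<open>Descents and ascents\<close>

text \<open>Treats descents (\<open>R\<close> is \<open>\<le>\<close>) and ascents (\<open>R\<close>
  is \<open>\<ge>\<close>) at once; positions are 1-based, so their sum is the major index.\<close>

definition breaks :: "('a \<Rightarrow> 'a \<Rightarrow> bool) \<Rightarrow> 'a list \<Rightarrow> nat set" where
  "breaks R \<gamma> = {i \<in> {1..<length \<gamma>}. \<not> R (\<gamma> ! (i - 1)) (\<gamma> ! i)}"

lemma finite_breaks [simp]: "finite (breaks R \<gamma>)"
  by (simp add: breaks_def)

lemma breaks_short [simp]: "breaks R [] = {}" "breaks R [x] = {}"
  by (auto simp: breaks_def)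

lemma breaks_snoc:
  assumes "\<gamma> \<noteq> []"
  shows "breaks R (\<gamma> @ [x]) =
    (if R (last \<gamma>) x then breaks R \<gamma> else insert (length \<gamma>) (breaks R \<gamma>))"
  using assms by (auto simp: breaks_def nth_append last_conv_nth less_Suc_eq)

lemma length_notin_breaks [simp]: "length \<gamma> \<notin> breaks R \<gamma>"
  by (simp add: breaks_def)

lemma card_breaks_less: "\<gamma> \<noteq> [] \<Longrightarrow> card (breaks R \<gamma>) < length \<gamma>"
proof -
  assume "\<gamma> \<noteq> []"
  moreover have "card (breaks R \<gamma>) \<le> card {1..<length \<gamma>}"
    by (rule card_mono) (auto simp: breaks_def)
  ultimately show ?thesis by (cases \<gamma>) auto
qed

text \<open>Counts the cuts into \<open>p\<close> possibly empty sorted factors: these are the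
  weakly increasing sequences of numbers below \<open>p\<close> that increase strictly at the
  breaks.\<close>

primrec sorted_power :: "('a \<Rightarrow> 'a \<Rightarrow> bool) \<Rightarrow> nat \<Rightarrow> 'a list \<Rightarrow> nat" where
  "sorted_power R 0 = unit_character"
| "sorted_power R (Suc p) = conv (sorted_power R p) (sorted_character R)"

lemma sorted_power_Nil [simp]: "sorted_power R p [] = 1"
  by (induction p) (simp_all add: unit_character_def conv_sorted_Nil)

lemma sorted_power_singleton: "sorted_power R p [x] = p"
  by (induction p) (simp_all add: unit_character_def conv_sorted_singleton)

text \<open>Appending a letter turns the recursion of \<open>conv_sorted_snoc\<close> into Pascal's
  rule, whether or not a break arises.\<close>

lemma sorted_power_eq_binomial:
  assumes "transp R" "\<gamma> \<noteq> []"
  shows "sorted_power R p \<gamma> = (length \<gamma> + p - Suc (card (breaks R \<gamma>))) choose length \<gamma>"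
  using assms(2)
proof (induction \<gamma> arbitrary: p rule: rev_nonempty_induct)
  case (single x)
  then show ?case by (simp add: sorted_power_singleton)
next
  case (snoc x \<gamma>)
  have less: "card (breaks R \<gamma>) < length \<gamma>" by (rule card_breaks_less) fact
  show ?case
  proof (induction p)
    case 0
    then show ?case by (simp add: unit_character_def)
  next
    case (Suc p)
    have IH': "conv (sorted_power R p) (sorted_character R) \<gamma> =
        (length \<gamma> + Suc p - Suc (card (breaks R \<gamma>))) choose length \<gamma>"
      using snoc.IH[of "Suc p"] by simp
    \<comment> \<open>There are fewer breaks than letters, so the truncated subtraction is
      exact.\<close>
    obtain d where d: "length \<gamma> = Suc (card (breaks R \<gamma>) + d)"
      using less by (auto simp: less_iff_Suc_add)
    show ?case
      using Suc snoc.hyps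
      by (simp add: conv_sorted_snoc[OF assms(1)] IH' snoc.IH breaks_snoc)
        (simp add: d)
  qed
qed

declare sorted_power.simps [simp del]

lemma image_card_breaks_Sh_eq:
  fixes R :: "'a \<Rightarrow> 'a \<Rightarrow> bool"
  assumes tr: "transp R" and tot: "\<And>a b. a \<noteq> b \<Longrightarrow> R a b \<noteq> R b a"
    and disj: "set \<alpha> \<inter> set \<beta> = {}" "set \<alpha>' \<inter> set \<beta>' = {}"
    and len: "length \<alpha> = length \<alpha>'" "length \<beta> = length \<beta>'"
    and st: "card (breaks R \<alpha>) = card (breaks R \<alpha>')" "card (breaks R \<beta>) = card (breaks R \<beta>')"
  shows "image_mset (\<lambda>\<gamma>. card (breaks R \<gamma>)) (Sh \<alpha> \<beta>) =
         image_mset (\<lambda>\<gamma>. card (breaks R \<gamma>)) (Sh \<alpha>' \<beta>')"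
proof (rule image_mset_Sh_eq_if_triangular[where \<phi> = "\<lambda>p. sorted_power R (Suc p)"])
  have "shuffle_character (sorted_power R p)" for p
    by (induction p) (simp_all add: sorted_power.simps shuffle_character_unit shuffle_character_conv
        shuffle_character_sorted[OF tr tot])
  then show "shuffle_character (sorted_power R (Suc p))" for p .
  show "sorted_power R (Suc p) \<gamma> = sorted_power R (Suc p) \<gamma>'"
    if "length \<gamma> = length \<gamma>'" "card (breaks R \<gamma>) = card (breaks R \<gamma>')" for p \<gamma> \<gamma>'
  proof (cases "\<gamma> = []")
    case False
    then have "\<gamma>' \<noteq> []" using that by auto
    then show ?thesis
      using False that by (simp add: sorted_power_eq_binomial[OF tr])
  qed (use that in auto)
  \<comment> \<open>The shift to \<open>Suc p\<close> matters: on a nonempty word the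
    \<open>p\<close>-th power still vanishes when \<open>p\<close> equals the number of breaks, and
    the next power has the value \<open>length \<gamma> choose length \<gamma>\<close>.\<close>
  show "sorted_power R (Suc p) \<gamma> = 0" if "p < card (breaks R \<gamma>)" for p \<gamma>
  proof -
    have "\<gamma> \<noteq> []" using that by auto
    then show ?thesis using that card_breaks_less[of \<gamma> R]
      by (simp add: sorted_power_eq_binomial[OF tr] binomial_eq_0)
  qed
  show "sorted_power R (Suc (card (breaks R \<gamma>))) \<gamma> > 0" for \<gamma>
  proof (cases "\<gamma> = []")
    case False
    then show ?thesis by (simp add: sorted_power_eq_binomial[OF tr])
  qed simp
qed fact+

subsection \<open>Major index\<close>

text \<open>The sum over the shuffles and the product satisfy the same recursion. By induction on
  the total length their difference reproduces itself with factor
  \<open>q ^ (length \<alpha> + length \<beta>)\<close>, which is not 1 unless both words are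
  empty.\<close>

lemma shuffle_character_fixed_point:
  fixes F \<zeta> :: "'a list \<Rightarrow> 'b::idom" and q :: 'b
  assumes \<zeta>: "shuffle_character \<zeta>" "\<zeta> [] = 1" and F: "F [] = 1"
    and q: "\<And>n. n > 0 \<Longrightarrow> q ^ n \<noteq> 1"
    and fp: "\<And>\<gamma>. F \<gamma> = conv (\<lambda>\<gamma>. q ^ length \<gamma> * F \<gamma>) \<zeta> \<gamma>"
  shows "shuffle_character F"
proof -
  have "(\<Sum>\<gamma>\<in>#Sh \<alpha> \<beta>. F \<gamma>) = F \<alpha> * F \<beta>" if "set \<alpha> \<inter> set \<beta> = {}" for \<alpha> \<beta>
    using that
  proof (induction "length \<alpha> + length \<beta>" arbitrary: \<alpha> \<beta> rule: less_induct)
    case less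
    let ?m = "length \<alpha>" and ?n = "length \<beta>"
    define S where "S i j = (\<Sum>\<gamma>\<in>#Sh (take i \<alpha>) (take j \<beta>). F \<gamma>)" for i j
    define D where "D i j = S i j - F (take i \<alpha>) * F (take j \<beta>)" for i j
    define z where "z i j = \<zeta> (drop i \<alpha>) * \<zeta> (drop j \<beta>)" for i j
    note dd = disjoint_take_drop[OF less.prems]
    \<comment> \<open>Lengths add under shuffling, so the weight \<open>q ^ length \<gamma>\<close>
      is constant on each sum.\<close>
    have 1: "(\<Sum>\<gamma>\<in>#Sh (take i \<alpha>) (take j \<beta>). q ^ length \<gamma> * F \<gamma>) = q ^ (i + j) * S i j"
      if "i \<le> ?m" "j \<le> ?n" for i j
      unfolding S_def sum_mset_distrib_left
      by (intro arg_cong[where f = sum_mset] image_mset_cong)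
        (use that in \<open>simp add: length_of_mem_Sh\<close>)
    have "S ?m ?n = (\<Sum>\<gamma>\<in>#Sh \<alpha> \<beta>. conv (\<lambda>\<gamma>. q ^ length \<gamma> * F \<gamma>) \<zeta> \<gamma>)"
      unfolding S_def by (simp flip: fp)
    also have "\<dots> = (\<Sum>i\<le>?m. \<Sum>j\<le>?n. q ^ (i + j) * S i j * z i j)"
      unfolding sum_Sh_conv z_def using \<zeta>(1) dd
      by (intro sum.cong) (simp_all add: 1 shuffle_character_def)
    finally have S: "S ?m ?n = (\<Sum>i\<le>?m. \<Sum>j\<le>?n. q ^ (i + j) * S i j * z i j)" .
    have "F \<alpha> * F \<beta> = conv (\<lambda>\<gamma>. q ^ length \<gamma> * F \<gamma>) \<zeta> \<alpha> * conv (\<lambda>\<gamma>. q ^ length \<gamma> * F \<gamma>) \<zeta> \<beta>"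
      by (simp flip: fp)
    also have "\<dots> = (\<Sum>i\<le>?m. \<Sum>j\<le>?n. q ^ (i + j) * (F (take i \<alpha>) * F (take j \<beta>)) * z i j)"
      unfolding conv_def sum_product z_def
      by (intro sum.cong refl) (simp add: power_add ac_simps)
    finally have "D ?m ?n = (\<Sum>i\<le>?m. \<Sum>j\<le>?n. q ^ (i + j) * D i j * z i j)"
      unfolding D_def by (simp add: S algebra_simps sum_subtractf)
    \<comment> \<open>By induction the defect \<open>D\<close> vanishes on all proper pairs of
      prefixes; at the full pair the dropped parts are empty and
      \<open>\<zeta> [] = 1\<close>.\<close>
    also have "\<dots> = (\<Sum>i\<le>?m. \<Sum>j\<le>?n. if i = ?m then if j = ?n then q ^ (?m + ?n) * D ?m ?n else 0 else 0)"
    proof (intro sum.cong refl)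
      fix i j assume ij: "i \<in> {..?m}" "j \<in> {..?n}"
      show "q ^ (i + j) * D i j * z i j =
          (if i = ?m then if j = ?n then q ^ (?m + ?n) * D ?m ?n else 0 else 0)"
      proof (cases "i = ?m \<and> j = ?n")
        case False
        then have "D i j = 0"
          unfolding D_def S_def using less.hyps[OF _ dd(1), of i j] ij by force
        then show ?thesis using False by auto
      qed (simp add: z_def \<zeta>)
    qed
    also have "\<dots> = q ^ (?m + ?n) * D ?m ?n"
      by (subst sum.swap) simp
    finally have "(1 - q ^ (?m + ?n)) * D ?m ?n = 0"
      by (simp add: algebra_simps)
    then have "?m + ?n = 0 \<or> D ?m ?n = 0"
      using q[of "?m + ?n"] by auto
    then show ?case
      by (auto simp: D_def S_def F)
  qed
  then show ?thesis by (simp add: shuffle_character_def)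
qed

text \<open>Solves the fixed-point equation above with \<open>q = X\<close>: it is the generating function of the
  decreasing sequences compatible with the breaks, and splitting off the trailing zeros gives
  the convolution.\<close>

definition maj_series :: "('a \<Rightarrow> 'a \<Rightarrow> bool) \<Rightarrow> 'a list \<Rightarrow> rat fps" where
  "maj_series R \<gamma> = fps_X ^ \<Sum>(breaks R \<gamma>) * inverse (\<Prod>i\<in>{1..length \<gamma>}. 1 - fps_X ^ i)"

section \<open>The major index series as a solution of the fixed-point equation\<close>

lemma prod_one_minus_fps_X_nth_0: "fps_nth (\<Prod>i\<in>{1..n}. 1 - fps_X ^ i :: rat fps) 0 = 1"
  by (induction n) (auto simp: fps_X_power_iff)

lemma one_minus_mult_inverse_prod:
  "(1 - fps_X ^ Suc n) * inverse (\<Prod>i\<in>{1..Suc n}. 1 - fps_X ^ i) =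
   inverse (\<Prod>i\<in>{1..n}. 1 - fps_X ^ i :: rat fps)"
proof -
  let ?a = "1 - fps_X ^ Suc n :: rat fps" and ?P = "\<Prod>i\<in>{1..n}. 1 - fps_X ^ i :: rat fps"
  have "?a * inverse ?a = 1"
    by (rule inverse_mult_eq_1') (auto simp: fps_X_power_iff)
  moreover have "inverse (\<Prod>i\<in>{1..Suc n}. 1 - fps_X ^ i :: rat fps) = inverse ?P * inverse ?a"
    by (simp add: fps_inverse_mult mult.commute del: power_Suc)
  moreover have "?a * (inverse ?P * inverse ?a) = inverse ?P * (?a * inverse ?a)"
    by (rule mult.left_commute)
  ultimately show ?thesis
    by (simp only: mult_1_right)
qed

text \<open>A new break sits at position \<open>length \<gamma>\<close> and contributes this power
  of \<open>fps_X\<close>; the new denominator factor is cleared on the left.\<close>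

lemma maj_series_snoc:
  assumes "\<gamma> \<noteq> []"
  shows "(1 - fps_X ^ Suc (length \<gamma>)) * maj_series R (\<gamma> @ [x]) =
    (if R (last \<gamma>) x then 1 else fps_X ^ length \<gamma>) * maj_series R \<gamma>"
  using one_minus_mult_inverse_prod[of "length \<gamma>"] assms
  by (simp add: maj_series_def breaks_snoc power_add mult.left_commute mult.assoc
      del: power_Suc prod.cl_ivl_Suc)

lemma shuffle_character_maj_series:
  assumes tr: "transp R" and tot: "\<And>a b. a \<noteq> b \<Longrightarrow> R a b \<noteq> R b a"
  shows "shuffle_character (maj_series R)"
proof (rule shuffle_character_fixed_point[where q = fps_X])
  show "shuffle_character (sorted_character R :: _ \<Rightarrow> rat fps)"
    by (rule shuffle_character_sorted[OF tr tot])
  show "fps_X ^ n \<noteq> (1 :: rat fps)" if "n > 0" for n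
    using that by (auto dest: arg_cong[where f = "\<lambda>f. fps_nth f 0"])
  let ?G = "\<lambda>\<gamma>. fps_X ^ length \<gamma> * maj_series R \<gamma>"
  have Nil: "maj_series R [] = 1" by (simp add: maj_series_def)
  then show "maj_series R [] = 1" .
  show "maj_series R \<gamma> = conv ?G (sorted_character R) \<gamma>" for \<gamma>
  proof (cases "\<gamma> = []")
    case False
    then show ?thesis
    proof (induction \<gamma> rule: rev_nonempty_induct)
      case (single x)
      have "(1 - fps_X) * maj_series R [x] = 1"
        using one_minus_mult_inverse_prod[of 0] by (simp add: maj_series_def)
      then show ?case
        by (simp add: conv_sorted_singleton Nil algebra_simps)
    next
      case (snoc x \<gamma>)
      have "maj_series R (\<gamma> @ [x]) = fps_X ^ Suc (length \<gamma>) * maj_series R (\<gamma> @ [x]) +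
          (if R (last \<gamma>) x then 1 else fps_X ^ length \<gamma>) * maj_series R \<gamma>"
        using maj_series_snoc[OF snoc.hyps, of R x] by (simp add: algebra_simps del: power_Suc)
      \<comment> \<open>If no break arises, the convolution at \<open>\<gamma>\<close> is
        \<open>maj_series R \<gamma>\<close> by induction; at a break the term
        \<open>?G \<gamma>\<close> supplies exactly the factor
        \<open>fps_X ^ length \<gamma>\<close>.\<close>
      also have "\<dots> = conv ?G (sorted_character R) (\<gamma> @ [x])"
        using snoc.hyps by (simp add: conv_sorted_snoc[OF tr] snoc.IH[symmetric] del: power_Suc)
      finally show ?case .
    qed
  qed (simp add: conv_sorted_Nil Nil)
qed (simp add: sorted_character_def)

lemma fps_nth_sum_mset_X_power:
  "fps_nth (\<Sum>x\<in>#A. fps_X ^ f x :: 'b::comm_semiring_1 fps) k = of_nat (count (image_mset f A) k)"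
  by (induction A) (auto simp: fps_X_power_nth)

text \<open>The denominator of \<open>maj_series\<close> depends on the length only, so it is common
  to all shuffles and cancels. The coefficients of the remaining polynomial are the
  multiplicities.\<close>

lemma image_sum_breaks_Sh_eq:
  fixes R :: "'a \<Rightarrow> 'a \<Rightarrow> bool"
  assumes tr: "transp R" and tot: "\<And>a b. a \<noteq> b \<Longrightarrow> R a b \<noteq> R b a"
    and disj: "set \<alpha> \<inter> set \<beta> = {}" "set \<alpha>' \<inter> set \<beta>' = {}"
    and len: "length \<alpha> = length \<alpha>'" "length \<beta> = length \<beta>'"
    and st: "\<Sum>(breaks R \<alpha>) = \<Sum>(breaks R \<alpha>')" "\<Sum>(breaks R \<beta>) = \<Sum>(breaks R \<beta>')"
  shows "image_mset (\<lambda>\<gamma>. \<Sum>(breaks R \<gamma>)) (Sh \<alpha> \<beta>) = image_mset (\<lambda>\<gamma>. \<Sum>(breaks R \<gamma>)) (Sh \<alpha>' \<beta>')"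
proof -
  let ?P = "\<lambda>n. \<Prod>i\<in>{1..n}. 1 - fps_X ^ i :: rat fps"
  have sum: "(\<Sum>\<gamma>\<in>#Sh \<alpha> \<beta>. maj_series R \<gamma>) =
      (\<Sum>\<gamma>\<in>#Sh \<alpha> \<beta>. fps_X ^ \<Sum>(breaks R \<gamma>)) * inverse (?P (length \<alpha> + length \<beta>))" for \<alpha> \<beta> :: "'a list"
    unfolding sum_mset_distrib_right
    by (intro arg_cong[where f = sum_mset] image_mset_cong)
      (simp add: maj_series_def length_of_mem_Sh)
  have "(\<Sum>\<gamma>\<in>#Sh \<alpha> \<beta>. maj_series R \<gamma>) = (\<Sum>\<gamma>\<in>#Sh \<alpha>' \<beta>'. maj_series R \<gamma>)"
    using shuffle_character_maj_series[OF tr tot] disj st len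
    by (simp add: shuffle_character_def maj_series_def)
  moreover have "inverse (?P n) \<noteq> 0" for n
    using prod_one_minus_fps_X_nth_0[of n] fps_inverse_0_iff[of "?P n"]
    by (metis fps_zero_nth zero_neq_one)
  ultimately have "(\<Sum>\<gamma>\<in>#Sh \<alpha> \<beta>. fps_X ^ \<Sum>(breaks R \<gamma>) :: rat fps) =
      (\<Sum>\<gamma>\<in>#Sh \<alpha>' \<beta>'. fps_X ^ \<Sum>(breaks R \<gamma>))"
    unfolding sum len mult_cancel_right by blast
  then show ?thesis
    by (intro multiset_eqI) (metis fps_nth_sum_mset_X_power of_nat_eq_iff)
qed

subsection \<open>Cliffs\<close>

lemma cliff_short [simp]: "cliff [] = 0" "cliff [x] = 0" "cliff [x, y] = 0"
  by (simp_all add: cliff_def)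

text \<open>A cliff involves three consecutive letters, so whether \<open>x\<close> completes one is
  decided by the two letters before it.\<close>

lemma cliff_snoc:
  assumes "\<delta> \<noteq> []"
  shows "cliff (\<delta> @ [y, x]) = cliff (\<delta> @ [y]) + of_bool (last \<delta> \<le> y \<and> x < y)"
proof -
  let ?n = "Suc (length \<delta>)"
  let ?P = "\<lambda>\<alpha> i. \<alpha> ! (i - 2) \<le> \<alpha> ! (i - 1) \<and> \<alpha> ! (i - 1) > (\<alpha> ! i :: nat)"
  have nth: "(\<delta> @ [y, x]) ! k = (\<delta> @ [y]) ! k" if "k < ?n" for k
    using that by (cases "k = length \<delta>") (simp_all add: nth_append)
  have P: "?P (\<delta> @ [y, x]) i \<longleftrightarrow> ?P (\<delta> @ [y]) i" if "i \<in> {2..<?n}" for i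
  proof -
    have "i - 1 < ?n" "i - 2 < ?n" "i < ?n" using that by auto
    then show ?thesis by (simp only: nth)
  qed
  have Pn: "?P (\<delta> @ [y, x]) ?n \<longleftrightarrow> last \<delta> \<le> y \<and> x < y"
    using assms by (simp add: nth_append last_conv_nth)
  have n: "2 \<le> ?n" using assms by (cases \<delta>) auto
  have "{i \<in> {2..<Suc ?n}. ?P (\<delta> @ [y, x]) i} =
      {i \<in> {2..<?n}. ?P (\<delta> @ [y, x]) i} \<union> {i. i = ?n \<and> ?P (\<delta> @ [y, x]) i}"
    using n by (auto simp only: atLeastLessThan_iff less_Suc_eq)
  also have "{i \<in> {2..<?n}. ?P (\<delta> @ [y, x]) i} = {i \<in> {2..<?n}. ?P (\<delta> @ [y]) i}"
    using P by blast
  also have "{i. i = ?n \<and> ?P (\<delta> @ [y, x]) i} = (if last \<delta> \<le> y \<and> x < y then {?n} else {})"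
    using Pn by auto
  finally have "cliff (\<delta> @ [y, x]) =
      card ({i \<in> {2..<?n}. ?P (\<delta> @ [y]) i} \<union> (if last \<delta> \<le> y \<and> x < y then {?n} else {}))"
    by (simp only: cliff_def length_append list.size add_Suc_right add_0_right)
  then show ?thesis
    by (simp add: cliff_def)
qed

text \<open>Counts factorizations into \<open>2 p\<close> possibly empty factors, alternately strictly decreasing and weakly
  increasing; these are the enriched \<open>P\<close>-partitions of Stembridge.\<close>

primrec enriched_power :: "nat \<Rightarrow> nat list \<Rightarrow> nat" where
  "enriched_power 0 = unit_character"
| "enriched_power (Suc p) =
     conv (conv (enriched_power p) (sorted_character (>))) (sorted_character (\<le>))"

section \<open>Recursions of the enriched powers under appending a letter\<close>

lemma enriched_power_Nil [simp]: "enriched_power p [] = 1"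
  by (induction p) (simp_all add: unit_character_def conv_sorted_Nil)

lemma enriched_power_singleton: "enriched_power p [x] = 2 * p"
  by (induction p) (simp_all add: unit_character_def conv_sorted_singleton conv_sorted_Nil)

lemma enriched_power_0 [simp]: "\<gamma> \<noteq> [] \<Longrightarrow> enriched_power 0 \<gamma> = 0"
  by (simp add: unit_character_def)

lemma shuffle_character_enriched_power: "shuffle_character (enriched_power p)"
proof -
  have "shuffle_character (sorted_character (>) :: nat list \<Rightarrow> nat)"
    "shuffle_character (sorted_character (\<le>) :: nat list \<Rightarrow> nat)"
    by (rule shuffle_character_sorted; auto)+
  then show ?thesis
    by (induction p) (simp_all add: shuffle_character_unit shuffle_character_conv)
qed

text \<open>For \<open>y \<le> x\<close> this is read off from \<open>conv_sorted_snoc\<close>. For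
  \<open>x < y\<close> the half-step \<open>conv (enriched_power p) (sorted_character (>))\<close>
  occurs twice at \<open>\<delta> @ [y]\<close>; if \<open>y\<close> ends a descent or starts the
  word, twice its value is the sum of the \<open>p\<close>-th and the next enriched power
  there.\<close>

lemma enriched_power_snoc_no_cliff:
  assumes "\<delta> = [] \<or> \<not> (last \<delta> \<le> y \<and> x < y)"
  shows "enriched_power (Suc p) (\<delta> @ [y, x]) =
    enriched_power p (\<delta> @ [y, x]) + enriched_power p (\<delta> @ [y]) + enriched_power (Suc p) (\<delta> @ [y])"
proof -
  note snoc = conv_sorted_snoc[where \<gamma> = "\<delta> @ [y]" and x = x, simplified]
  consider "y \<le> x" | "x < y" "\<delta> = []" | "x < y" "\<delta> \<noteq> []" "y < last \<delta>"
    using assms by fastforce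
  then show ?thesis
  proof cases
    case 2
    then show ?thesis
      by (simp add: conv_sorted_snoc[where \<gamma> = "[y]" and x = x, simplified]
          conv_sorted_singleton conv_sorted_Nil enriched_power_singleton)
  qed (simp_all add: snoc conv_sorted_snoc)
qed

text \<open>Again the half-step at \<open>\<delta> @ [y]\<close> occurs twice, but
  \<open>last \<delta> \<le> y\<close> makes it \<open>enriched_power p (\<delta> @ [y]) +
  enriched_power p \<delta>\<close>.\<close>

lemma enriched_power_snoc_cliff:
  assumes "\<delta> \<noteq> []" "last \<delta> \<le> y" "x < y"
  shows "enriched_power (Suc p) (\<delta> @ [y, x]) =
    enriched_power p (\<delta> @ [y, x]) + 2 * enriched_power p (\<delta> @ [y]) + 2 * enriched_power p \<delta>"
  using assms
  by (simp add: conv_sorted_snoc[where \<gamma> = "\<delta> @ [y]" and x = x, simplified] conv_sorted_snoc)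

declare enriched_power.simps [simp del]

text \<open>As a series in \<open>p\<close> the two recursions become multiplications by rational functions, whose
  product depends only on the number of steps of each kind.\<close>

definition enriched_series :: "nat list \<Rightarrow> int fps" where
  "enriched_series \<gamma> = Abs_fps (\<lambda>p. int (enriched_power p \<gamma>))"

section \<open>Product formula for the enriched series\<close>

lemma enriched_series_singleton: "(1 - fps_X) ^ 2 * enriched_series [x] = 2 * fps_X"
proof -
  \<comment> \<open>The sequence \<open>2 * p\<close> has zero second differences; the last summand
    accounts for its start.\<close>
  have "enriched_series [x] = 2 * fps_X * enriched_series [x] - fps_X * (fps_X * enriched_series [x]) + 2 * fps_X"
    by (rule fps_ext)
      (auto simp: enriched_series_def enriched_power_singleton mult.assoc numeral_fps_const
        fps_X_nth of_nat_diff)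
  then show ?thesis by (simp add: power2_eq_square algebra_simps)
qed

lemma enriched_series_snoc_no_cliff:
  assumes "\<delta> = [] \<or> \<not> (last \<delta> \<le> y \<and> x < y)"
  shows "(1 - fps_X) * enriched_series (\<delta> @ [y, x]) = (1 + fps_X) * enriched_series (\<delta> @ [y])"
proof -
  have "enriched_series (\<delta> @ [y, x]) = fps_X * enriched_series (\<delta> @ [y, x]) +
     fps_X * enriched_series (\<delta> @ [y]) + enriched_series (\<delta> @ [y])"
  proof (rule fps_ext)
    show "fps_nth (enriched_series (\<delta> @ [y, x])) p = fps_nth (fps_X * enriched_series (\<delta> @ [y, x]) +
     fps_X * enriched_series (\<delta> @ [y]) + enriched_series (\<delta> @ [y])) p" for p
      by (cases p) (simp_all add: enriched_series_def enriched_power_snoc_no_cliff[OF assms])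
  qed
  then show ?thesis by (simp add: algebra_simps)
qed

lemma enriched_series_snoc_cliff:
  assumes "\<delta> \<noteq> []" "last \<delta> \<le> y" "x < y"
  shows "(1 - fps_X) * (1 + fps_X) * enriched_series (\<delta> @ [y, x]) =
    4 * fps_X * enriched_series (\<delta> @ [y])"
proof -
  have "enriched_series (\<delta> @ [y, x]) = fps_X * enriched_series (\<delta> @ [y, x]) +
     2 * (fps_X * enriched_series (\<delta> @ [y])) + 2 * (fps_X * enriched_series \<delta>)"
  proof (rule fps_ext)
    show "fps_nth (enriched_series (\<delta> @ [y, x])) p = fps_nth (fps_X * enriched_series (\<delta> @ [y, x]) +
     2 * (fps_X * enriched_series (\<delta> @ [y])) + 2 * (fps_X * enriched_series \<delta>)) p" for p
      using assms(1) by (cases p) (simp_all add: enriched_series_def numeral_fps_const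
          enriched_power_snoc_cliff[OF assms])
  qed
  then have 1: "(1 - fps_X) * enriched_series (\<delta> @ [y, x]) =
      2 * fps_X * (enriched_series (\<delta> @ [y]) + enriched_series \<delta>)"
    by (simp add: algebra_simps)
  obtain \<epsilon> w where \<delta>: "\<delta> = \<epsilon> @ [w]" using assms(1) by (cases \<delta> rule: rev_cases) auto
  \<comment> \<open>Appending \<open>y\<close> to \<open>\<delta>\<close> creates no cliff, and this
    relation eliminates \<open>enriched_series \<delta>\<close>.\<close>
  then have "(1 - fps_X) * enriched_series (\<delta> @ [y]) = (1 + fps_X) * enriched_series \<delta>"
    using enriched_series_snoc_no_cliff[of \<epsilon> w y] assms by simp
  then show ?thesis using 1 by algebra
qed

text \<open>Each further letter contributes \<open>(1 + fps_X) / (1 - fps_X)\<close>, times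
  \<open>4 * fps_X / (1 + fps_X) ^ 2\<close> if it completes a cliff; denominators are multiplied
  out.\<close>

lemma enriched_series_eq:
  assumes "\<gamma> \<noteq> []"
  shows "(1 - fps_X) ^ Suc (length \<gamma>) * (1 + fps_X) ^ (2 * cliff \<gamma>) * enriched_series \<gamma> =
    2 * fps_X * (4 * fps_X) ^ cliff \<gamma> * (1 + fps_X) ^ (length \<gamma> - 1)"
  using assms
proof (induction \<gamma> rule: rev_nonempty_induct)
  case (single x)
  then show ?case using enriched_series_singleton[of x] by (simp add: power2_eq_square)
next
  case (snoc x \<gamma>)
  obtain n where n: "length \<gamma> = Suc n" using snoc.hyps by (cases \<gamma>) auto
  let ?a = "1 - fps_X :: int fps" and ?b = "1 + fps_X :: int fps"
  obtain \<delta> y where \<gamma>: "\<gamma> = \<delta> @ [y]" using snoc.hyps by (cases \<gamma> rule: rev_cases) auto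
  show ?case
  proof (cases "\<delta> \<noteq> [] \<and> last \<delta> \<le> y \<and> x < y")
    case True
    then have c: "cliff (\<gamma> @ [x]) = Suc (cliff \<gamma>)" by (simp add: \<gamma> cliff_snoc)
    have "?a ^ Suc (length (\<gamma> @ [x])) * ?b ^ (2 * cliff (\<gamma> @ [x])) * enriched_series (\<gamma> @ [x]) =
        ?a ^ Suc (length \<gamma>) * ?b ^ (2 * cliff \<gamma>) * ?b * (?a * ?b * enriched_series (\<gamma> @ [x]))"
      by (simp add: c)
    also have "?a * ?b * enriched_series (\<gamma> @ [x]) = 4 * fps_X * enriched_series \<gamma>"
      using enriched_series_snoc_cliff[of \<delta> y x] True by (simp add: \<gamma>)
    also have "?a ^ Suc (length \<gamma>) * ?b ^ (2 * cliff \<gamma>) * ?b * (4 * fps_X * enriched_series \<gamma>) =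
        4 * fps_X * ?b * (?a ^ Suc (length \<gamma>) * ?b ^ (2 * cliff \<gamma>) * enriched_series \<gamma>)"
      by (simp only: ac_simps)
    finally show ?thesis unfolding snoc.IH by (simp add: c n)
  next
    case False
    then have c: "cliff (\<gamma> @ [x]) = cliff \<gamma>" by (cases "\<delta> = []") (auto simp add: \<gamma> cliff_snoc)
    have "(1 - fps_X) * enriched_series (\<gamma> @ [x]) = (1 + fps_X) * enriched_series \<gamma>"
      using enriched_series_snoc_no_cliff[of \<delta> y x] False by (simp add: \<gamma>)
    then have "?a ^ Suc (length (\<gamma> @ [x])) * ?b ^ (2 * cliff (\<gamma> @ [x])) * enriched_series (\<gamma> @ [x]) =
        ?a ^ Suc (length \<gamma>) * ?b ^ (2 * cliff \<gamma>) * (?b * enriched_series \<gamma>)"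
      by (simp add: c)
    also have "\<dots> = ?b * (?a ^ Suc (length \<gamma>) * ?b ^ (2 * cliff \<gamma>) * enriched_series \<gamma>)"
      by (simp only: ac_simps)
    finally show ?thesis unfolding snoc.IH by (simp add: c n)
  qed
qed

lemma enriched_power_determined:
  assumes "length \<gamma> = length \<gamma>'" "cliff \<gamma> = cliff \<gamma>'"
  shows "enriched_power p \<gamma> = enriched_power p \<gamma>'"
proof (cases "\<gamma> = []")
  case False
  then have "\<gamma>' \<noteq> []" using assms by auto
  have "1 - fps_X \<noteq> (0 :: int fps)" "1 + fps_X \<noteq> (0 :: int fps)"
    by (auto dest: arg_cong[where f = "\<lambda>f. fps_nth f 0"])
  then have nz: "(1 - fps_X) ^ m * (1 + fps_X) ^ n \<noteq> (0 :: int fps)" for m n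
    by simp
  have "enriched_series \<gamma> = enriched_series \<gamma>'"
    using enriched_series_eq[OF False] enriched_series_eq[OF \<open>\<gamma>' \<noteq> []\<close>] nz
    unfolding assms by (metis mult_left_cancel)
  then have "fps_nth (enriched_series \<gamma>) p = fps_nth (enriched_series \<gamma>') p" by simp
  then show ?thesis by (simp add: enriched_series_def)
qed (use assms in simp)

text \<open>Matches the lowest term of the product formula, of degree
  \<open>Suc (cliff \<gamma>)\<close>. The proof uses the recursions over the naturals instead,
  where no cancellation can occur.\<close>

lemma enriched_power_triangular:
  assumes "\<gamma> \<noteq> []"
  shows "p \<le> cliff \<gamma> \<Longrightarrow> enriched_power p \<gamma> = 0" "enriched_power (Suc (cliff \<gamma>)) \<gamma> > 0"
proof -
  have "(\<forall>p. p \<le> cliff \<gamma> \<longrightarrow> enriched_power p \<gamma> = 0) \<and> enriched_power (Suc (cliff \<gamma>)) \<gamma> > 0"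
    using assms
  proof (induction \<gamma> rule: rev_nonempty_induct)
    case (single x)
    then show ?case by (simp add: enriched_power_singleton)
  next
    case (snoc x \<gamma>)
    obtain \<delta> y where \<gamma>: "\<gamma> = \<delta> @ [y]" using snoc.hyps by (cases \<gamma> rule: rev_cases) auto
    show ?case
    proof (cases "\<delta> \<noteq> [] \<and> last \<delta> \<le> y \<and> x < y")
      case True
      then have c: "cliff (\<gamma> @ [x]) = Suc (cliff \<gamma>)" by (simp add: \<gamma> cliff_snoc)
      have rec: "enriched_power (Suc p) (\<gamma> @ [x]) =
          enriched_power p (\<gamma> @ [x]) + 2 * enriched_power p \<gamma> + 2 * enriched_power p \<delta>" for p
        using enriched_power_snoc_cliff[of \<delta> y x p] True by (simp add: \<gamma>)
      have "enriched_power (Suc p) \<gamma> =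
          enriched_power p \<gamma> + enriched_power p \<delta> + enriched_power (Suc p) \<delta>" for p
      proof -
        obtain \<epsilon> w where "\<delta> = \<epsilon> @ [w]" using True by (cases \<delta> rule: rev_cases) auto
        then show ?thesis using enriched_power_snoc_no_cliff[of \<epsilon> w y p] True
          by (simp add: \<gamma>)
      qed
      \<comment> \<open>The summands of a vanishing sum of naturals vanish, so the zeros at
        \<open>\<gamma>\<close> pass to its prefix \<open>\<delta>\<close>.\<close>
      then have \<delta>: "enriched_power p \<delta> = 0" if "p \<le> cliff \<gamma>" for p
        using that snoc.IH True by (cases p) auto
      have "enriched_power p (\<gamma> @ [x]) = 0" if "p \<le> Suc (cliff \<gamma>)" for p
        using that snoc.IH \<delta> by (induction p) (auto simp: rec)
      then show ?thesis unfolding c using snoc.IH by (simp add: rec[of "Suc _"])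
    next
      case False
      then have c: "cliff (\<gamma> @ [x]) = cliff \<gamma>" by (cases "\<delta> = []") (auto simp add: \<gamma> cliff_snoc)
      have rec: "enriched_power (Suc p) (\<gamma> @ [x]) =
          enriched_power p (\<gamma> @ [x]) + enriched_power p \<gamma> + enriched_power (Suc p) \<gamma>" for p
        using enriched_power_snoc_no_cliff[of \<delta> y x p] False by (simp add: \<gamma>)
      have "enriched_power p (\<gamma> @ [x]) = 0" if "p \<le> cliff \<gamma>" for p
        using that snoc.IH by (induction p) (auto simp: rec)
      then show ?thesis unfolding c using snoc.IH by (simp add: rec)
    qed
  qed
  then show "p \<le> cliff \<gamma> \<Longrightarrow> enriched_power p \<gamma> = 0" "enriched_power (Suc (cliff \<gamma>)) \<gamma> > 0"
    by auto
qed

lemma image_cliff_Sh_eq: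
  assumes "set \<alpha> \<inter> set \<beta> = {}" "set \<alpha>' \<inter> set \<beta>' = {}"
    and "length \<alpha> = length \<alpha>'" "length \<beta> = length \<beta>'"
    and "cliff \<alpha> = cliff \<alpha>'" "cliff \<beta> = cliff \<beta>'"
  shows "image_mset cliff (Sh \<alpha> \<beta>) = image_mset cliff (Sh \<alpha>' \<beta>')"
proof (rule image_mset_Sh_eq_if_triangular[where \<phi> = "\<lambda>p. enriched_power (Suc p)"])
  show "enriched_power (Suc p) \<gamma> = 0" if "p < cliff \<gamma>" for p \<gamma>
    using that by (intro enriched_power_triangular) auto
  show "enriched_power (Suc (cliff \<gamma>)) \<gamma> > 0" for \<gamma>
    by (cases "\<gamma> = []") (auto simp: enriched_power_triangular)
qed (use assms in \<open>auto intro: shuffle_character_enriched_power enriched_power_determined\<close>)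

subsection \<open>Packing\<close>

text \<open>The rank of a letter is strictly monotone on the letters of the word, because the larger
  letter counts itself.\<close>

lemma pack_nth_less_iff:
  assumes "i < length \<alpha>" "j < length \<alpha>"
  shows "pack \<alpha> ! i < pack \<alpha> ! j \<longleftrightarrow> \<alpha> ! i < \<alpha> ! j"
proof -
  have mono: "card {b \<in> set \<alpha>. b \<le> x} \<le> card {b \<in> set \<alpha>. b \<le> y}" if "x \<le> y" for x y
    using that by (intro card_mono) auto
  have "card {b \<in> set \<alpha>. b \<le> x} < card {b \<in> set \<alpha>. b \<le> y}" if "x < y" "y \<in> set \<alpha>" for x y
  proof (rule psubset_card_mono)
    have "y \<in> {b \<in> set \<alpha>. b \<le> y} - {b \<in> set \<alpha>. b \<le> x}" using that by simp
    then show "{b \<in> set \<alpha>. b \<le> x} \<subset> {b \<in> set \<alpha>. b \<le> y}" using that by fastforce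
  qed simp
  then show ?thesis
    using assms mono[of "\<alpha> ! j" "\<alpha> ! i"] by (auto simp: pack_def not_less[symmetric])
qed

text \<open>Packing preserves and reflects comparisons of letters, so invariance under equal order
  patterns yields the condition on \<open>pack\<close>.\<close>

lemma shuffle_compatible_on_wordsI:
  assumes "\<And>\<alpha> \<beta> \<alpha>' \<beta>'. set \<alpha> \<inter> set \<beta> = {} \<Longrightarrow> set \<alpha>' \<inter> set \<beta>' = {} \<Longrightarrow>
      length \<alpha> = length \<alpha>' \<Longrightarrow> length \<beta> = length \<beta>' \<Longrightarrow> st \<alpha> = st \<alpha>' \<Longrightarrow> st \<beta> = st \<beta>' \<Longrightarrow>
      image_mset st (Sh \<alpha> \<beta>) = image_mset st (Sh \<alpha>' \<beta>')"
    and pk: "\<And>\<alpha> \<beta>. length \<alpha> = length \<beta> \<Longrightarrow>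
      (\<And>i j. i < length \<beta> \<Longrightarrow> j < length \<beta> \<Longrightarrow> \<alpha> ! i < \<alpha> ! j \<longleftrightarrow> \<beta> ! i < \<beta> ! j) \<Longrightarrow> st \<alpha> = st \<beta>"
  shows "shuffle_compatible_on_words st"
proof -
  have "st \<alpha> = st \<beta>" if eq: "pack \<alpha> = pack \<beta>" for \<alpha> \<beta>
  proof (rule pk)
    show len: "length \<alpha> = length \<beta>" using arg_cong[OF eq, of length] by (simp add: pack_def)
    show "\<alpha> ! i < \<alpha> ! j \<longleftrightarrow> \<beta> ! i < \<beta> ! j" if "i < length \<beta>" "j < length \<beta>" for i j
      using that len pack_nth_less_iff[of i \<alpha> j] pack_nth_less_iff[of i \<beta> j] eq by simp
  qed
  then show ?thesis
    unfolding shuffle_compatible_on_words_def disjoint_words_def using assms(1) by blast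
qed

theorem corollary3p13:
  shows "shuffle_compatible_on_words des \<and> shuffle_compatible_on_words asc \<and>
         shuffle_compatible_on_words maj \<and> shuffle_compatible_on_words cliff"
proof (intro conjI; rule shuffle_compatible_on_wordsI)
  have des: "des = (\<lambda>\<gamma>. card (breaks (\<le>) \<gamma>))" and asc: "asc = (\<lambda>\<gamma>. card (breaks (\<ge>) \<gamma>))"
    and maj: "maj = (\<lambda>\<gamma>. \<Sum>(breaks (\<le>) \<gamma>))"
    by (simp_all add: fun_eq_iff des_def asc_def maj_def breaks_def not_le)
  fix \<alpha> \<beta> \<alpha>' \<beta>' :: "nat list"
  assume disj: "set \<alpha> \<inter> set \<beta> = {}" "set \<alpha>' \<inter> set \<beta>' = {}"
    and len: "length \<alpha> = length \<alpha>'" "length \<beta> = length \<beta>'"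
  show "image_mset des (Sh \<alpha> \<beta>) = image_mset des (Sh \<alpha>' \<beta>')" if "des \<alpha> = des \<alpha>'" "des \<beta> = des \<beta>'"
    using that disj len unfolding des by (intro image_card_breaks_Sh_eq) auto
  show "image_mset asc (Sh \<alpha> \<beta>) = image_mset asc (Sh \<alpha>' \<beta>')" if "asc \<alpha> = asc \<alpha>'" "asc \<beta> = asc \<beta>'"
    using that disj len unfolding asc by (intro image_card_breaks_Sh_eq) auto
  show "image_mset maj (Sh \<alpha> \<beta>) = image_mset maj (Sh \<alpha>' \<beta>')" if "maj \<alpha> = maj \<alpha>'" "maj \<beta> = maj \<beta>'"
    using that disj len unfolding maj by (intro image_sum_breaks_Sh_eq) auto
  show "image_mset cliff (Sh \<alpha> \<beta>) = image_mset cliff (Sh \<alpha>' \<beta>')"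
    if "cliff \<alpha> = cliff \<alpha>'" "cliff \<beta> = cliff \<beta>'"
    using that disj len by (intro image_cliff_Sh_eq) auto
next
  fix \<alpha> \<beta> :: "nat list"
  assume len: "length \<alpha> = length \<beta>"
    and cmp: "\<And>i j. i < length \<beta> \<Longrightarrow> j < length \<beta> \<Longrightarrow> \<alpha> ! i < \<alpha> ! j \<longleftrightarrow> \<beta> ! i < \<beta> ! j"
  have D: "{i \<in> {1..<length \<alpha>}. \<alpha> ! (i - 1) > \<alpha> ! i} = {i \<in> {1..<length \<beta>}. \<beta> ! (i - 1) > \<beta> ! i}"
    using len cmp by auto
  show "des \<alpha> = des \<beta>" "maj \<alpha> = maj \<beta>"
    by (simp_all only: des_def maj_def D)
  have "{i \<in> {1..<length \<alpha>}. \<alpha> ! (i - 1) < \<alpha> ! i} = {i \<in> {1..<length \<beta>}. \<beta> ! (i - 1) < \<beta> ! i}"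
    using len cmp by auto
  then show "asc \<alpha> = asc \<beta>"
    by (simp only: asc_def)
  have "{i \<in> {2..<length \<alpha>}. \<alpha> ! (i - 2) \<le> \<alpha> ! (i - 1) \<and> \<alpha> ! (i - 1) > \<alpha> ! i} =
      {i \<in> {2..<length \<beta>}. \<beta> ! (i - 2) \<le> \<beta> ! (i - 1) \<and> \<beta> ! (i - 1) > \<beta> ! i}"
    \<comment> \<open>Only strict comparisons are known to agree, so weak ones are read as negated
      strict ones.\<close>
    using len cmp by (auto simp: not_less[symmetric])
  then show "cliff \<alpha> = cliff \<beta>"
    by (simp only: cliff_def)
qed

end
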